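(* Let $A(u),B(u)$ be $n\times n$ matrices depending smoothly on $u=(u_1,\dots,u_n)$, and consider the quasi-linear system $$A(u)u_x+B(u)u_y=0 \qquad (\ast)$$ for a vector function $u(x,y)=(u_1,\dots,u_n)$. Assume that the homogeneous polynomial $P(\alpha,\beta)=\det(\alpha B-\beta A)$ of degree $n$ is not the zero polynomial at any point $(x,y)$, and that the system is strictly hyperbolic, i.e. $P$ has $n$ distinct real roots $[\beta_i:\alpha_i]$, $i=1,\dots,n$, with characteristic angles $\phi_i$ and characteristic unit vector fields $v_i$. Assume that $(\ast)$ is Rich, that is: by a regular change of variables $(u_1,\dots,u_n)\to(r_1,\dots,r_n)$ it can be written in the diagonal form $$L_{v_i}r_i=\cos\phi_i\,(r_i)_x+\sin\phi_i\,(r_i)_y=0,\qquad i=1,\dots,n,$$ and the characteristic angles $\phi_i=\phi_i(r_1,\dots,r_n)$ satisfy $$\partial_{r_k}\left(\frac{\partial_{r_i}\phi_j}{\tan(\phi_i-\phi_j)}\right)=\partial_{r_i}\left(\frac{\partial_{r_k}\phi_j}{\tan(\phi_k-\phi_j)}\right)\qquad\text{for all } j \text{ and all } i,k\neq j .$$ Then there exist (locally in the space of Riemann invariants) functions $G_j=G_j(r_1,\dots,r_n)$, $j=1,\dots,n$, satisfying $$\partial_{r_i}G_j=\frac{\partial_{r_i}\phi_j}{\tan(\phi_i-\phi_j)}\qquad\text{for all } i\neq j,$$ and for any such functions and any smooth solution, the derivatives $w_i=L_{v_i^\perp}r_i$ of the Riemann invariants in the direction orthogonal to the characteristics satisfy,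 for every $i=1,\dots,n$, the Riccati equation $$L_{v_i}\bigl(e^{-G_i}w_i\bigr)+e^{G_i}\,(\partial_{r_i}\phi_i)\,\bigl(e^{-G_i}w_i\bigr)^2=0 .$$
   Context: The characteristic angles $\phi_i$ are defined by $[\sin\phi_i:\cos\phi_i]=[\beta_i:\alpha_i]$, where $[\beta_i:\alpha_i]$ are the roots of $P(\alpha,\beta)=\det(\alpha B-\beta A)$; strict hyperbolicity means $\phi_i\neq\phi_j \pmod \pi$ for $i\neq j$. The characteristic unit vector fields on the plane $\mathbb{R}^2(x,y)$ are $v_i=\cos\phi_i\,\partial_x+\sin\phi_i\,\partial_y$, and $v_i^\perp=-\sin\phi_i\,\partial_x+\cos\phi_i\,\partial_y$ is $v_i$ rotated by $90^\circ$ counterclockwise. $L_v$ denotes the derivative of a function of $(x,y)$ along the vector field $v$; functions of $r_1,\dots,r_n$ (such as $\phi_i$, $G_i$) are regarded as functions of $(x,y)$ by evaluating them on the solution $r(x,y)$. The variables $r_i$ are called Riemann invariants. Saying that the system can be written in a certain form means that this form can be achieved by a regular change of variables $u=\Psi(r)$ and multiplication by an invertible matrix $C(r)$, i.e. by passing to $C(r)A(\Psi(r))D\Psi(r)\,r_x+C(r)B(\Psi(r))D\Psi(r)\,r_y=0$, where $D$ is the differential. Convention: $1/\tan(\theta)$ means $\cot\theta=\cos\theta/\sin\theta$ (so it equals $0$ when $\theta=\pi/2 \bmod \pi$). All functions are assumed smooth. *)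

theory Defs
  imports "HOL-Analysis.Analysis"
begin

text \<open>Only used on open sets \<open>S\<close>, where it is the usual notion of a \<open>C\<^sup>k\<close> function.\<close>

primrec Ck_on :: "nat \<Rightarrow> ('a::real_normed_vector \<Rightarrow> 'b::real_normed_vector) \<Rightarrow> 'a set \<Rightarrow> bool" where
  "Ck_on 0 f S \<longleftrightarrow> continuous_on S f"
| "Ck_on (Suc k) f S \<longleftrightarrow>
     (\<forall>x\<in>S. f differentiable (at x)) \<and>
     (\<forall>h. Ck_on k (\<lambda>x. frechet_derivative f (at x) h) S)"

definition smooth_on :: "('a::real_normed_vector \<Rightarrow> 'b::real_normed_vector) \<Rightarrow> 'a set \<Rightarrow> bool" where
  "smooth_on f S \<longleftrightarrow> (\<forall>k. Ck_on k f S)"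

definition partial :: "'n \<Rightarrow> (real ^ 'n::finite \<Rightarrow> real) \<Rightarrow> real ^ 'n \<Rightarrow> real" where
  "partial i f r = frechet_derivative f (at r) (axis i 1)"

definition lie :: "(real \<times> real \<Rightarrow> real \<times> real) \<Rightarrow> (real \<times> real \<Rightarrow> 'b::real_normed_vector)
    \<Rightarrow> real \<times> real \<Rightarrow> 'b" where
  "lie v f p = frechet_derivative f (at p) (v p)"

definition is_solution :: "(real ^ 'n::finite \<Rightarrow> real ^ 'n ^ 'n) \<Rightarrow> (real ^ 'n \<Rightarrow> real ^ 'n ^ 'n)
    \<Rightarrow> (real \<times> real) set \<Rightarrow> (real \<times> real \<Rightarrow> real ^ 'n) \<Rightarrow> bool" where
  "is_solution A B \<Omega> u \<longleftrightarrow>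
     (\<forall>p\<in>\<Omega>. A (u p) *v lie (\<lambda>_. (1, 0)) u p + B (u p) *v lie (\<lambda>_. (0, 1)) u p = 0)"

definition char_form :: "real ^ 'n ^ 'n \<Rightarrow> real ^ 'n ^ 'n::finite \<Rightarrow> real \<Rightarrow> real \<Rightarrow> real" where
  "char_form M N \<alpha> \<beta> = det (\<alpha> *\<^sub>R N - \<beta> *\<^sub>R M)"

text \<open>Equality \<open>[b : a] = [b' : a']\<close> in the real projective line, for nonzero pairs.\<close>

definition proj_eq :: "real \<times> real \<Rightarrow> real \<times> real \<Rightarrow> bool" where
  "proj_eq P Q \<longleftrightarrow> (\<exists>c. c \<noteq> 0 \<and> P = c *\<^sub>R Q)"

text \<open>The roots \<open>[\<beta> i : \<alpha> i]\<close> are indexed by the index type of the matrices, so there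
  are exactly as many of them as the degree of the characteristic form.\<close>

definition char_roots :: "real ^ 'n ^ 'n \<Rightarrow> real ^ 'n ^ 'n::finite \<Rightarrow> ('n \<Rightarrow> real) \<Rightarrow> ('n \<Rightarrow> real) \<Rightarrow> bool" where
  "char_roots M N \<beta> \<alpha> \<longleftrightarrow>
     (\<forall>i. (\<beta> i, \<alpha> i) \<noteq> (0, 0) \<and> char_form M N (\<alpha> i) (\<beta> i) = 0) \<and>
     (\<forall>i j. i \<noteq> j \<longrightarrow> \<not> proj_eq (\<beta> i, \<alpha> i) (\<beta> j, \<alpha> j))"

definition strictly_hyperbolic :: "real ^ 'n ^ 'n \<Rightarrow> real ^ 'n ^ 'n::finite \<Rightarrow> bool" where
  "strictly_hyperbolic M N \<longleftrightarrow> (\<exists>\<beta> \<alpha>. char_roots M N \<beta> \<alpha>)"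

definition char_angles :: "real ^ 'n ^ 'n \<Rightarrow> real ^ 'n ^ 'n::finite \<Rightarrow> ('n \<Rightarrow> real) \<Rightarrow> bool" where
  "char_angles M N \<theta> \<longleftrightarrow>
     (\<exists>\<beta> \<alpha>. char_roots M N \<beta> \<alpha> \<and> (\<forall>i. proj_eq (sin (\<theta> i), cos (\<theta> i)) (\<beta> i, \<alpha> i)))"

definition regular_change_of_variables ::
    "(real ^ 'n::finite) set \<Rightarrow> (real ^ 'n) set \<Rightarrow> (real ^ 'n \<Rightarrow> real ^ 'n) \<Rightarrow> bool" where
  "regular_change_of_variables V U \<Psi> \<longleftrightarrow>
     open V \<and> open U \<and> bij_betw \<Psi> V U \<and> smooth_on \<Psi> V \<and> smooth_on (the_inv_into V \<Psi>) U"

text \<open>Substituting \<open>u = \<Psi>(r)\<close> into \<open>A(u) u\<^sub>x + B(u) u\<^sub>y = 0\<close> and multiplying by an invertible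
  matrix \<open>C(r)\<close> gives \<open>A'(r) r\<^sub>x + B'(r) r\<^sub>y = 0\<close>.\<close>

definition can_be_written_as ::
    "(real ^ 'n::finite \<Rightarrow> real ^ 'n ^ 'n) \<Rightarrow> (real ^ 'n \<Rightarrow> real ^ 'n ^ 'n)
      \<Rightarrow> (real ^ 'n) set \<Rightarrow> (real ^ 'n) set \<Rightarrow> (real ^ 'n \<Rightarrow> real ^ 'n)
      \<Rightarrow> (real ^ 'n \<Rightarrow> real ^ 'n ^ 'n) \<Rightarrow> (real ^ 'n \<Rightarrow> real ^ 'n ^ 'n) \<Rightarrow> bool" where
  "can_be_written_as A B U V \<Psi> A' B' \<longleftrightarrow>
     regular_change_of_variables V U \<Psi> \<and>
     (\<exists>C. smooth_on C V \<and>
       (\<forall>r\<in>V. invertible (C r) \<and>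
          C r ** A (\<Psi> r) ** jacobian \<Psi> (at r) = A' r \<and>
          C r ** B (\<Psi> r) ** jacobian \<Psi> (at r) = B' r))"

definition diag_matrix :: "('n \<Rightarrow> real) \<Rightarrow> real ^ 'n ^ 'n::finite" where
  "diag_matrix d = (\<chi> i j. if i = j then d i else 0)"

text \<open>\<open>\<phi> i\<close> is the \<open>i\<close>-th characteristic angle as a function of the Riemann invariants.\<close>

definition rich ::
    "(real ^ 'n::finite \<Rightarrow> real ^ 'n ^ 'n) \<Rightarrow> (real ^ 'n \<Rightarrow> real ^ 'n ^ 'n)
      \<Rightarrow> (real ^ 'n) set \<Rightarrow> (real ^ 'n) set \<Rightarrow> (real ^ 'n \<Rightarrow> real ^ 'n)
      \<Rightarrow> ('n \<Rightarrow> real ^ 'n \<Rightarrow> real) \<Rightarrow> bool" where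
  "rich A B U V \<Psi> \<phi> \<longleftrightarrow>
     can_be_written_as A B U V \<Psi>
       (\<lambda>r. diag_matrix (\<lambda>i. cos (\<phi> i r))) (\<lambda>r. diag_matrix (\<lambda>i. sin (\<phi> i r))) \<and>
     (\<forall>r\<in>V. \<forall>i j k. i \<noteq> j \<and> k \<noteq> j \<longrightarrow>
        partial k (\<lambda>s. partial i (\<phi> j) s * cot (\<phi> i s - \<phi> j s)) r =
        partial i (\<lambda>s. partial k (\<phi> j) s * cot (\<phi> k s - \<phi> j s)) r)"

definition char_field :: "(real \<times> real \<Rightarrow> real) \<Rightarrow> real \<times> real \<Rightarrow> real \<times> real" where
  "char_field \<theta> p = (cos (\<theta> p), sin (\<theta> p))"

definition char_field_perp :: "(real \<times> real \<Rightarrow> real) \<Rightarrow> real \<times> real \<Rightarrow> real \<times> real" where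
  "char_field_perp \<theta> p = (- sin (\<theta> p), cos (\<theta> p))"

definition riccati_weights :: "('n::finite \<Rightarrow> real ^ 'n \<Rightarrow> real) \<Rightarrow> (real ^ 'n) set
    \<Rightarrow> ('n \<Rightarrow> real ^ 'n \<Rightarrow> real) \<Rightarrow> bool" where
  "riccati_weights \<phi> W G \<longleftrightarrow>
     (\<forall>j. smooth_on (G j) W) \<and>
     (\<forall>r\<in>W. \<forall>i j. i \<noteq> j \<longrightarrow>
        partial i (G j) r = partial i (\<phi> j) r * cot (\<phi> i r - \<phi> j r))"

end

theory Submission
  imports Defs
begin

text \<open>Write \<open>\<nabla>r\<^sub>k = w\<^sub>k (- sin \<phi>\<^sub>k, cos \<phi>\<^sub>k)\<close>, which is the diagonal system. Equality of the mixed second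
  derivatives of \<open>r\<^sub>i\<close> gives \<open>L\<^sub>v w\<^sub>i = - w\<^sub>i L\<^sub>v\<^sub>' \<phi>\<^sub>i = - w\<^sub>i (\<Sum>k. \<partial>\<^sub>k\<phi>\<^sub>i cos (\<phi>\<^sub>k - \<phi>\<^sub>i) w\<^sub>k)\<close>, where \<open>v, v'\<close> are the
  unit tangent and normal of the \<open>i\<close>-th characteristic. Since \<open>L\<^sub>v r\<^sub>k = - sin (\<phi>\<^sub>k - \<phi>\<^sub>i) w\<^sub>k\<close>, the terms
  with \<open>k \<noteq> i\<close> add up to \<open>w\<^sub>i L\<^sub>v G\<^sub>i\<close> and are absorbed by the factor \<open>exp (- G\<^sub>i)\<close>; the term \<open>k = i\<close> is
  the quadratic one. The functions \<open>G\<^sub>j\<close> come from the Poincare lemma in the variables other than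
  \<open>r\<^sub>j\<close>, the Rich condition being the closedness of the form.\<close>

section \<open>Calculus of \<open>C\<^sup>k\<close> functions\<close>

text \<open>Derivatives are local, so on an open set they see only the values inside it; agreement
  on \<open>S\<close> therefore passes to all derivatives by induction.\<close>

lemma Ck_on_cong:
  assumes "Ck_on k f S" "open S" "\<And>x. x \<in> S \<Longrightarrow> f x = g x"
  shows "Ck_on k g S"
  using assms(1,3)
proof (induction k arbitrary: f g)
  case 0
  then show ?case by (metis Ck_on.simps(1) continuous_on_cong)
next
  case (Suc k)
  have D: "(g has_derivative frechet_derivative f (at x)) (at x)" if "x \<in> S" for x
    by (rule has_derivative_transform_within_open[OF _ assms(2) that, of f])
      (use Suc.prems that in \<open>auto simp: frechet_derivative_works\<close>)
  have "Ck_on k (\<lambda>x. frechet_derivative g (at x) h) S" for h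
    by (rule Suc.IH[of "\<lambda>x. frechet_derivative f (at x) h"])
      (use Suc.prems(1) frechet_derivative_at[OF D] in auto)
  then show ?case using D by (auto simp: differentiable_def)
qed

lemma Ck_on_has_derivative:
  "Ck_on (Suc k) f S \<Longrightarrow> x \<in> S \<Longrightarrow> (f has_derivative frechet_derivative f (at x)) (at x)"
  by (simp add: frechet_derivative_works)

text \<open>By uniqueness of the derivative, any explicit formula \<open>f'\<close> may replace
  \<open>frechet_derivative\<close>. The closure properties below feed it the usual differentiation
  rules.\<close>

lemma Ck_on_Suc_intro:
  assumes "open S" "\<And>x. x \<in> S \<Longrightarrow> (f has_derivative f' x) (at x)"
    and "\<And>h. Ck_on k (\<lambda>x. f' x h) S"
  shows "Ck_on (Suc k) f S"
proof -
  have "Ck_on k (\<lambda>x. frechet_derivative f (at x) h) S" for h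
    by (rule Ck_on_cong[OF assms(3)[of h] assms(1)]) (use frechet_derivative_at[OF assms(2)] in auto)
  then show ?thesis using assms(2) by (auto simp: differentiable_def)
qed

lemma Ck_on_mono: "Ck_on (Suc k) f S \<Longrightarrow> Ck_on k f S"
proof (induction k arbitrary: f)
  case 0
  then show ?case
    by (auto intro: continuous_at_imp_continuous_on differentiable_imp_continuous_within)
next
  case (Suc k)
  then show ?case by (metis Ck_on.simps(2))
qed

lemma Ck_on_imp_continuous_on: "Ck_on k f S \<Longrightarrow> continuous_on S f"
  by (induction k) (auto dest: Ck_on_mono simp del: Ck_on.simps(2))

lemma Ck_on_subset: "Ck_on k f S \<Longrightarrow> T \<subseteq> S \<Longrightarrow> Ck_on k f T"
  by (induction k arbitrary: f) (auto intro: continuous_on_subset)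

lemma Ck_on_const: "Ck_on k (\<lambda>_. c) S"
  by (induction k arbitrary: c) (auto simp: frechet_derivative_const)

lemma Ck_on_bounded_linear_comp:
  assumes "bounded_linear L" "open S" "Ck_on k f S"
  shows "Ck_on k (\<lambda>x. L (f x)) S"
  using assms(3)
proof (induction k arbitrary: f)
  case 0
  then show ?case using bounded_linear.continuous_on[OF assms(1)] by auto
next
  case (Suc k)
  show ?case
    by (rule Ck_on_Suc_intro[OF assms(2)
          bounded_linear.has_derivative[OF assms(1) Ck_on_has_derivative[OF Suc.prems]]])
      (use Suc in auto)
qed

lemma Ck_on_bounded_linear:
  assumes "bounded_linear L" "open S"
  shows "Ck_on k L S"
proof (cases k)
  case 0
  then show ?thesis using assms by (simp add: linear_continuous_on)
next
  case (Suc m)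
  show ?thesis
    unfolding Suc
    by (rule Ck_on_Suc_intro[OF assms(2) bounded_linear_imp_has_derivative[OF assms(1)] Ck_on_const])
qed

lemma Ck_on_add:
  assumes "open S" "Ck_on k f S" "Ck_on k g S"
  shows "Ck_on k (\<lambda>x. f x + g x) S"
  using assms(2,3)
proof (induction k arbitrary: f g)
  case 0
  then show ?case by (auto intro: continuous_intros)
next
  case (Suc k)
  show ?case
    by (rule Ck_on_Suc_intro[OF assms(1)
          has_derivative_add[OF Ck_on_has_derivative[OF Suc.prems(1)] Ck_on_has_derivative[OF Suc.prems(2)]]])
      (use Suc in auto)
qed

lemma Ck_on_sum:
  assumes "open S" "\<And>i. i \<in> I \<Longrightarrow> Ck_on k (f i) S"
  shows "Ck_on k (\<lambda>x. \<Sum>i\<in>I. f i x) S"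
  using assms(2)
  by (induction I rule: infinite_finite_induct) (auto intro: Ck_on_const Ck_on_add[OF assms(1)])

lemma Ck_on_uminus:
  assumes "open S" "Ck_on k f S"
  shows "Ck_on k (\<lambda>x. - f x) S"
  using Ck_on_bounded_linear_comp[OF bounded_linear_minus[OF bounded_linear_ident] assms] .

lemma Ck_on_diff:
  assumes "open S" "Ck_on k f S" "Ck_on k g S"
  shows "Ck_on k (\<lambda>x. f x - g x) S"
  using Ck_on_add[OF assms(1,2) Ck_on_uminus[OF assms(1,3)]] by simp

text \<open>The product rule yields two terms of the same bilinear form, each with one factor
  differentiated; \<open>Ck_on_mono\<close> lowers the other factor to the same order, and induction
  applies.\<close>

lemma Ck_on_bilinear:
  assumes "bounded_bilinear B" "open S" "Ck_on k f S" "Ck_on k g S"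
  shows "Ck_on k (\<lambda>x. B (f x) (g x)) S"
  using assms(3,4)
proof (induction k arbitrary: f g)
  case 0
  then show ?case using bounded_bilinear.continuous_on[OF assms(1)] by auto
next
  case (Suc k)
  show ?case
  proof (rule Ck_on_Suc_intro[OF assms(2)
        bounded_bilinear.FDERIV[OF assms(1) Ck_on_has_derivative[OF Suc.prems(1)]
          Ck_on_has_derivative[OF Suc.prems(2)]]])
    fix h
    show "Ck_on k (\<lambda>x. B (f x) (frechet_derivative g (at x) h)
        + B (frechet_derivative f (at x) h) (g x)) S"
    proof (rule Ck_on_add[OF assms(2)])
      show "Ck_on k (\<lambda>x. B (f x) (frechet_derivative g (at x) h)) S"
        using Suc.IH[OF Ck_on_mono[OF Suc.prems(1)]] Suc.prems(2) by simp
      show "Ck_on k (\<lambda>x. B (frechet_derivative f (at x) h) (g x)) S"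
        using Suc.IH[OF _ Ck_on_mono[OF Suc.prems(2)], of "\<lambda>x. frechet_derivative f (at x) h"]
          Suc.prems(1) by simp
    qed
  qed
qed

lemmas Ck_on_scaleR = Ck_on_bilinear[OF bounded_bilinear_scaleR]
lemmas Ck_on_mult = Ck_on_bilinear[OF bounded_bilinear_mult]

lemma Ck_on_compose:
  fixes g :: "'a::real_normed_vector \<Rightarrow> 'b::euclidean_space"
  assumes "open S" "g ` S \<subseteq> T" "Ck_on k f T" "Ck_on k g S"
  shows "Ck_on k (\<lambda>x. f (g x)) S"
  using assms(3,4)
proof (induction k arbitrary: f)
  case 0
  then show ?case using assms(2) continuous_on_compose2 by auto
next
  case (Suc k)
  \<comment> \<open>\<open>Ck_on\<close> controls derivatives only in fixed directions, but in the
    chain rule the direction \<open>frechet_derivative g (at x) h\<close> moves with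
    \<open>x\<close>. Expanding it in the basis leaves constant directions \<open>b\<close> with
    scalar coefficients, to which the induction hypothesis applies.\<close>
  have D: "((\<lambda>x. f (g x)) has_derivative
      (\<lambda>h. \<Sum>b\<in>Basis. (frechet_derivative g (at x) h \<bullet> b) *\<^sub>R frechet_derivative f (at (g x)) b)) (at x)"
    if "x \<in> S" for x
  proof -
    have f: "(f has_derivative frechet_derivative f (at (g x))) (at (g x))"
      using Suc.prems that assms(2) by (intro Ck_on_has_derivative) auto
    interpret linear "frechet_derivative f (at (g x))"
      using f has_derivative_linear by blast
    have "frechet_derivative f (at (g x)) y
        = (\<Sum>b\<in>Basis. (y \<bullet> b) *\<^sub>R frechet_derivative f (at (g x)) b)" for y
      by (subst euclidean_representation[of y, symmetric]) (simp add: sum scale)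
    then have "(\<lambda>h. \<Sum>b\<in>Basis. (frechet_derivative g (at x) h \<bullet> b) *\<^sub>R frechet_derivative f (at (g x)) b)
        = (\<lambda>h. frechet_derivative f (at (g x)) (frechet_derivative g (at x) h))"
      by metis
    then show ?thesis
      using has_derivative_compose[OF Ck_on_has_derivative[OF Suc.prems(2) that] f] by (simp only:)
  qed
  show ?case
  proof (rule Ck_on_Suc_intro[OF assms(1) D])
    fix h
    have "Ck_on k (\<lambda>x. frechet_derivative f (at (g x)) b) S" for b
      using Suc.IH[of "\<lambda>y. frechet_derivative f (at y) b"] Suc.prems(1) Ck_on_mono[OF Suc.prems(2)]
      by simp
    moreover have "Ck_on k (\<lambda>x. frechet_derivative g (at x) h \<bullet> b) S" for b
      using Suc.prems(2) by (intro Ck_on_bounded_linear_comp[OF bounded_linear_inner_left assms(1)]) auto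
    ultimately show "Ck_on k (\<lambda>x. \<Sum>b\<in>Basis. (frechet_derivative g (at x) h \<bullet> b)
        *\<^sub>R frechet_derivative f (at (g x)) b) S"
      by (intro Ck_on_sum Ck_on_scaleR assms(1))
  qed
qed

section \<open>Sine, cosine, inverse and cotangent\<close>

text \<open>Each function is, up to sign, the derivative of the other, hence the joint
  induction.\<close>

lemma Ck_on_sin_cos: "Ck_on k (sin :: real \<Rightarrow> real) UNIV \<and> Ck_on k (cos :: real \<Rightarrow> real) UNIV"
proof (induction k)
  case 0
  then show ?case by (simp add: continuous_at_imp_continuous_on)
next
  case (Suc k)
  have "((sin :: real \<Rightarrow> real) has_derivative (\<lambda>h. h * cos x)) (at x)"
    "((cos :: real \<Rightarrow> real) has_derivative (\<lambda>h. h * - sin x)) (at x)" for x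
    by (auto intro!: derivative_eq_intros)
  note D = this
  have "Ck_on k (\<lambda>x. h * cos x) UNIV" "Ck_on k (\<lambda>x. h * - sin x) UNIV" for h :: real
    by (rule Ck_on_mult[OF open_UNIV Ck_on_const], use Suc Ck_on_uminus[OF open_UNIV] in blast)+
  then show ?case
    using Ck_on_Suc_intro[OF open_UNIV D(1)] Ck_on_Suc_intro[OF open_UNIV D(2)] by blast
qed

lemma Ck_on_inverse: "Ck_on k (inverse :: real \<Rightarrow> real) (- {0})"
proof (induction k)
  case 0
  then show ?case by (auto intro: continuous_intros)
next
  case (Suc k)
  have "((inverse :: real \<Rightarrow> real) has_derivative (\<lambda>h. - (inverse x * h * inverse x))) (at x)"
    if "x \<in> - {0}" for x
    using that by (auto intro: has_derivative_inverse')
  moreover have "Ck_on k (\<lambda>x. - (inverse x * h * inverse x)) (- {0})" for h :: real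
    by (intro Ck_on_uminus Ck_on_mult Suc.IH Ck_on_const) auto
  ultimately show ?case
    by (intro Ck_on_Suc_intro) auto
qed

lemma Ck_on_cot:
  fixes f :: "'a::real_normed_vector \<Rightarrow> real"
  assumes "open S" "Ck_on k f S" "\<And>x. x \<in> S \<Longrightarrow> sin (f x) \<noteq> 0"
  shows "Ck_on k (\<lambda>x. cot (f x)) S"
proof -
  have sc: "Ck_on k (\<lambda>x. sin (f x)) S" "Ck_on k (\<lambda>x. cos (f x)) S"
    using Ck_on_compose[OF assms(1) subset_UNIV _ assms(2)] Ck_on_sin_cos[of k] by auto
  have "Ck_on k (\<lambda>x. inverse (sin (f x))) S"
    by (rule Ck_on_compose[OF assms(1) _ Ck_on_inverse sc(1)]) (use assms(3) in auto)
  then have "Ck_on k (\<lambda>x. cos (f x) * inverse (sin (f x))) S"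
    by (rule Ck_on_mult[OF assms(1) sc(2)])
  then show ?thesis by (simp add: cot_def divide_inverse)
qed

section \<open>Partial derivatives and smooth functions\<close>

lemma Ck_on_partial: "Ck_on (Suc k) f S \<Longrightarrow> Ck_on k (partial i f) S"
  unfolding partial_def by simp

lemma smooth_onD: "smooth_on f S \<Longrightarrow> Ck_on k f S"
  by (simp add: smooth_on_def)

lemma smooth_on_has_derivative:
  "smooth_on f S \<Longrightarrow> x \<in> S \<Longrightarrow> (f has_derivative frechet_derivative f (at x)) (at x)"
  using Ck_on_has_derivative smooth_onD by blast

lemma frechet_derivative_partial:
  assumes "f differentiable (at r)"
  shows "frechet_derivative f (at r) h = (\<Sum>k\<in>UNIV. partial k f r * h $ k)"
proof -
  interpret linear "frechet_derivative f (at r)"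
    using assms linear_frechet_derivative by blast
  have "frechet_derivative f (at r) h = frechet_derivative f (at r) (\<Sum>k\<in>UNIV. h $ k *\<^sub>R axis k 1)"
    using basis_expansion[of h] by (simp add: scalar_mult_eq_scaleR)
  also have "\<dots> = (\<Sum>k\<in>UNIV. partial k f r * h $ k)"
    by (simp add: sum scale partial_def mult.commute)
  finally show ?thesis .
qed

section \<open>Symmetry of second derivatives\<close>

text \<open>Mean value theorem twice: along \<open>h\<close> for the difference of \<open>f\<close>
  between the two sides parallel to \<open>h\<close>, then along \<open>k\<close> for the first
  derivative in direction \<open>h\<close>.\<close>

lemma second_difference_eq:
  fixes f :: "'a::real_normed_vector \<Rightarrow> real"
  assumes f: "Ck_on 2 f S" and s: "s > 0"
    and seg: "\<And>a b. a \<in> {0..s} \<Longrightarrow> b \<in> {0..s} \<Longrightarrow> p + a *\<^sub>R h + b *\<^sub>R k \<in> S"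
  obtains a b where "a \<in> {0..s}" "b \<in> {0..s}"
    "f (p + s *\<^sub>R h + s *\<^sub>R k) - f (p + s *\<^sub>R h) - f (p + s *\<^sub>R k) + f p
      = s * s * frechet_derivative (\<lambda>x. frechet_derivative f (at x) h) (at (p + a *\<^sub>R h + b *\<^sub>R k)) k"
proof -
  let ?x = "\<lambda>a b. p + a *\<^sub>R h + b *\<^sub>R k"
  let ?F = "\<lambda>x. frechet_derivative f (at x) h"
  have f1: "(f has_derivative frechet_derivative f (at x)) (at x)" if "x \<in> S" for x
    using f that by (simp add: numeral_2_eq_2 frechet_derivative_works)
  have f2: "(?F has_derivative frechet_derivative ?F (at x)) (at x)" if "x \<in> S" for x
    using f that by (simp add: numeral_2_eq_2 frechet_derivative_works)
  have da: "((\<lambda>a. f (?x a b)) has_real_derivative ?F (?x a b)) (at a)"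
    if "a \<in> {0..s}" "b \<in> {0..s}" for a b
  proof -
    have "((\<lambda>a. ?x a b) has_derivative (\<lambda>t. t *\<^sub>R h)) (at a)"
      by (auto intro!: derivative_eq_intros)
    from has_derivative_compose[OF this f1[OF seg[OF that]]]
    show ?thesis
      using linear_scale[OF has_derivative_linear[OF f1[OF seg[OF that]]]]
      by (simp add: has_field_derivative_def mult_commute_abs)
  qed
  have db: "((\<lambda>b. ?F (?x a b)) has_real_derivative frechet_derivative ?F (at (?x a b)) k) (at b)"
    if "a \<in> {0..s}" "b \<in> {0..s}" for a b
  proof -
    have "((\<lambda>b. ?x a b) has_derivative (\<lambda>t. t *\<^sub>R k)) (at b)"
      by (auto intro!: derivative_eq_intros)
    from has_derivative_compose[OF this f2[OF seg[OF that]]]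
    show ?thesis
      using linear_scale[OF has_derivative_linear[OF f2[OF seg[OF that]]]]
      by (simp add: has_field_derivative_def mult_commute_abs)
  qed
  have "((\<lambda>a. f (?x a s) - f (?x a 0)) has_real_derivative ?F (?x a s) - ?F (?x a 0)) (at a)"
    if "0 \<le> a" "a \<le> s" for a
    using that s by (intro DERIV_diff da) auto
  from MVT2[OF s this] obtain a where a: "0 < a" "a < s"
    "(f (?x s s) - f (?x s 0)) - (f (?x 0 s) - f (?x 0 0)) = (s - 0) * (?F (?x a s) - ?F (?x a 0))"
    by blast
  have "((\<lambda>b. ?F (?x a b)) has_real_derivative frechet_derivative ?F (at (?x a b)) k) (at b)"
    if "0 \<le> b" "b \<le> s" for b
    using that a by (intro db) auto
  from MVT2[OF s this] obtain b where b: "0 < b" "b < s"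
    "?F (?x a s) - ?F (?x a 0) = (s - 0) * frechet_derivative ?F (at (?x a b)) k"
    by blast
  show ?thesis
    by (rule that[of a b]) (use a b in auto)
qed

text \<open>The second difference does not change when \<open>h\<close> and \<open>k\<close> are
  exchanged, so arbitrarily close to \<open>p\<close> the two mixed derivatives share a value, each
  at its own point. By continuity they cannot differ at \<open>p\<close>.\<close>

lemma second_derivative_symmetric:
  fixes f :: "'a::real_normed_vector \<Rightarrow> real"
  assumes f: "Ck_on 2 f S" and "open S" "p \<in> S"
  shows "frechet_derivative (\<lambda>x. frechet_derivative f (at x) h) (at p) k
       = frechet_derivative (\<lambda>x. frechet_derivative f (at x) k) (at p) h"
proof (rule ccontr)
  let ?H = "\<lambda>x. frechet_derivative (\<lambda>x. frechet_derivative f (at x) h) (at x) k"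
  let ?K = "\<lambda>x. frechet_derivative (\<lambda>x. frechet_derivative f (at x) k) (at x) h"
  assume ne: "?H p \<noteq> ?K p"
  define e where "e = \<bar>?H p - ?K p\<bar> / 2"
  have e: "e > 0" using ne by (simp add: e_def)
  have "continuous_on S ?H" "continuous_on S ?K"
    using f by (simp_all add: numeral_2_eq_2)
  then have "isCont ?H p" "isCont ?K p"
    using assms(2,3) by (simp_all add: continuous_on_eq_continuous_at)
  then obtain d1 d2 where d1: "d1 > 0" "\<And>x. dist x p < d1 \<Longrightarrow> dist (?H x) (?H p) < e"
    and d2: "d2 > 0" "\<And>x. dist x p < d2 \<Longrightarrow> dist (?K x) (?K p) < e"
    using e unfolding continuous_at_eps_delta by metis
  obtain d3 where d3: "d3 > 0" "ball p d3 \<subseteq> S"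
    using assms(2,3) open_contains_ball by blast
  define d where "d = Min {d1, d2, d3}"
  have d: "d > 0" "d \<le> d1" "d \<le> d2" "d \<le> d3" using d1 d2 d3 by (auto simp: d_def)
  \<comment> \<open>The summand 1 keeps \<open>N\<close> positive when \<open>h\<close> and
    \<open>k\<close> both vanish, and makes the parallelogram of scale \<open>d / N\<close> lie
    strictly within distance \<open>d\<close> of \<open>p\<close>.\<close>
  define N where "N = norm h + norm k + 1"
  have N: "N > 0" by (simp add: N_def add_nonneg_pos)
  define s where "s = d / N"
  have s: "s > 0" using d N by (simp add: s_def)
  have near: "dist (p + a *\<^sub>R h + b *\<^sub>R k) p < d" if "a \<in> {0..s}" "b \<in> {0..s}" for a b
  proof -
    have "dist (p + a *\<^sub>R h + b *\<^sub>R k) p = norm (a *\<^sub>R h + b *\<^sub>R k)"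
      by (simp add: dist_norm algebra_simps)
    also have "\<dots> \<le> a * norm h + b * norm k"
      using norm_triangle_ineq[of "a *\<^sub>R h" "b *\<^sub>R k"] that by simp
    also have "\<dots> \<le> s * norm h + s * norm k"
      using that by (intro add_mono mult_right_mono) auto
    also have "\<dots> < s * N" using s by (simp add: N_def algebra_simps)
    also have "\<dots> = d" using N by (simp add: s_def)
    finally show ?thesis .
  qed
  have inS: "p + a *\<^sub>R h + b *\<^sub>R k \<in> S" if "a \<in> {0..s}" "b \<in> {0..s}" for a b
    using near[OF that] d d3 by (auto simp: dist_commute subset_eq)
  obtain a b where ab: "a \<in> {0..s}" "b \<in> {0..s}"
    "f (p + s *\<^sub>R h + s *\<^sub>R k) - f (p + s *\<^sub>R h) - f (p + s *\<^sub>R k) + f p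
      = s * s * ?H (p + a *\<^sub>R h + b *\<^sub>R k)"
    using second_difference_eq[OF f s, of p h k] inS by blast
  have inS': "p + a *\<^sub>R k + b *\<^sub>R h \<in> S" if "a \<in> {0..s}" "b \<in> {0..s}" for a b
    using inS[OF that(2,1)] by (simp add: algebra_simps)
  obtain a' b' where ab': "a' \<in> {0..s}" "b' \<in> {0..s}"
    "f (p + s *\<^sub>R k + s *\<^sub>R h) - f (p + s *\<^sub>R k) - f (p + s *\<^sub>R h) + f p
      = s * s * ?K (p + a' *\<^sub>R k + b' *\<^sub>R h)"
    using second_difference_eq[OF f s, of p k h] inS' by blast
  have "s * s * ?H (p + a *\<^sub>R h + b *\<^sub>R k) = s * s * ?K (p + b' *\<^sub>R h + a' *\<^sub>R k)"
    using ab(3) ab'(3) by (simp add: algebra_simps)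
  then have "?H (p + a *\<^sub>R h + b *\<^sub>R k) = ?K (p + b' *\<^sub>R h + a' *\<^sub>R k)"
    using s by simp
  moreover have "dist (?H (p + a *\<^sub>R h + b *\<^sub>R k)) (?H p) < e"
    using near[OF ab(1,2)] d by (intro d1) auto
  moreover have "dist (?K (p + b' *\<^sub>R h + a' *\<^sub>R k)) (?K p) < e"
    using near[OF ab'(2,1)] d by (intro d2) auto
  moreover have "\<bar>x - y\<bar> < 2 * e" if "dist z x < e" "dist z y < e" for x y z :: real
    using that unfolding dist_real_def by linarith
  ultimately have "\<bar>?H p - ?K p\<bar> < 2 * e" by metis
  then show False by (simp add: e_def)
qed

section \<open>Potentials depending on a parameter\<close>

text \<open>Differentiation under the integral sign. The derivative is again a parameter integral of
  the same kind, so an induction on the order gives the second claim. The open set \<open>S\<close>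
  makes room for full derivatives of \<open>F\<close> at the end points \<open>t = 0\<close> and
  \<open>t = 1\<close>.\<close>

lemma Ck_on_integral:
  fixes F :: "'a::euclidean_space \<times> real \<Rightarrow> real"
  assumes "open W" "convex W" "open S" "W \<times> {0..1} \<subseteq> S"
  shows "Ck_on (Suc 0) F S \<Longrightarrow> r \<in> W \<Longrightarrow>
      ((\<lambda>r. integral {0..1} (\<lambda>t. F (r, t))) has_derivative
        (\<lambda>h. integral {0..1} (\<lambda>t. frechet_derivative F (at (r, t)) (h, 0)))) (at r)"
    and "Ck_on k F S \<Longrightarrow> Ck_on k (\<lambda>r. integral {0..1} (\<lambda>t. F (r, t))) W"
proof -
  have cont: "continuous_on W (\<lambda>r. integral {0..1} (\<lambda>t. F (r, t)))"
    if "continuous_on S F" for F :: "'a \<times> real \<Rightarrow> real"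
  proof -
    have "continuous_on (W \<times> cbox 0 1) (\<lambda>(r, t). F (r, t))"
      using continuous_on_subset[OF that assms(4)] by (simp add: case_prod_unfold)
    from integral_continuous_on_param[OF this] show ?thesis by simp
  qed
  \<comment> \<open>Proved for every integrand, because the induction below applies it to
    derivatives of the original one.\<close>
  have D: "((\<lambda>r. integral {0..1} (\<lambda>t. F (r, t))) has_derivative
      (\<lambda>h. integral {0..1} (\<lambda>t. frechet_derivative F (at (r, t)) (h, 0)))) (at r)"
    if F: "Ck_on (Suc 0) F S" and r: "r \<in> W" for F :: "'a \<times> real \<Rightarrow> real" and r
  proof -
    let ?D = "\<lambda>r t h. frechet_derivative F (at (r, t)) (h, 0)"
    \<comment> \<open>The Leibniz rule asks for a derivative that is continuous as a map into
      bounded linear operators. \<open>Ck_on\<close> gives continuity in each direction separately,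
      which is enough in finite dimension. \<open>Blinfun\<close> is evaluated correctly only where
      the map is bounded linear, hence the restriction to \<open>S\<close> in
      \<open>app\<close>.\<close>
    define D' where "D' r t = Blinfun (?D r t)" for r t
    have der: "((\<lambda>r. F (r, t)) has_derivative ?D r t) (at r)" if "(r, t) \<in> S" for r t
    proof -
      have "((\<lambda>r. (r, t)) has_derivative (\<lambda>h. (h, 0))) (at r)"
        by (auto intro!: derivative_eq_intros)
      from has_derivative_compose[OF this, where g = F] Ck_on_has_derivative[OF F that]
      show ?thesis by simp
    qed
    have app: "blinfun_apply (D' r t) = ?D r t" if "(r, t) \<in> S" for r t
      unfolding D'_def using der[OF that] has_derivative_bounded_linear
      by (intro bounded_linear_Blinfun_apply) blast
    have cD: "continuous_on S (\<lambda>(r, t). ?D r t h)" for h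
      using F by (simp add: case_prod_unfold)
    have cont': "continuous_on (W \<times> cbox 0 1) (\<lambda>(r, t). D' r t)"
    proof (rule continuous_on_blinfun_componentwise)
      fix h :: 'a
      have "continuous_on (W \<times> cbox 0 1) (\<lambda>(r, t). ?D r t h)"
        using continuous_on_subset[OF cD assms(4)] by simp
      then show "continuous_on (W \<times> cbox 0 1) (\<lambda>x. blinfun_apply (case x of (r, t) \<Rightarrow> D' r t) h)"
        by (rule continuous_on_eq) (use app assms(4) in auto)
    qed
    have cF: "continuous_on S F"
      using F Ck_on_imp_continuous_on by blast
    have "((\<lambda>r. integral (cbox 0 1) (\<lambda>t. F (r, t))) has_derivative integral (cbox 0 1) (D' r)) (at r within W)"
    proof (rule leibniz_rule[OF _ _ cont' r assms(2)])
      fix r t assume "r \<in> W" "t \<in> cbox 0 (1::real)"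
      then have "(r, t) \<in> S" using assms(4) by auto
      then show "((\<lambda>r. F (r, t)) has_derivative blinfun_apply (D' r t)) (at r within W)"
        using der app has_derivative_at_withinI by metis
    next
      fix r assume "r \<in> W"
      then show "(\<lambda>t. F (r, t)) integrable_on cbox 0 1"
        using assms(4) by (intro integrable_continuous continuous_on_compose2[OF cF]) (auto intro!: continuous_intros)
    qed
    moreover have "blinfun_apply (integral (cbox 0 1) (D' r)) h = integral (cbox 0 1) (\<lambda>t. ?D r t h)" for h
    proof -
      have "D' r integrable_on cbox 0 1"
        using r by (intro integrable_continuous continuous_on_compose2[OF cont', of _ "\<lambda>t. (r, t)", simplified])
          (auto intro!: continuous_intros)
      then have "blinfun_apply (integral (cbox 0 1) (D' r)) h = integral (cbox 0 1) (\<lambda>t. blinfun_apply (D' r t) h)"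
        using blinfun_apply_integral by blast
      also have "\<dots> = integral (cbox 0 1) (\<lambda>t. ?D r t h)"
      proof (rule integral_cong)
        fix t assume "t \<in> cbox 0 (1::real)"
        then have "(r, t) \<in> S" using r assms(4) by auto
        then show "blinfun_apply (D' r t) h = ?D r t h" by (simp add: app)
      qed
      finally show ?thesis .
    qed
    then have "blinfun_apply (integral (cbox 0 1) (D' r)) = (\<lambda>h. integral (cbox 0 1) (\<lambda>t. ?D r t h))"
      by (rule ext)
    ultimately show ?thesis
      using at_within_open[OF r assms(1)] by simp
  qed
  show "Ck_on (Suc 0) F S \<Longrightarrow> r \<in> W \<Longrightarrow>
      ((\<lambda>r. integral {0..1} (\<lambda>t. F (r, t))) has_derivative
        (\<lambda>h. integral {0..1} (\<lambda>t. frechet_derivative F (at (r, t)) (h, 0)))) (at r)"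
    by (rule D)
  show "Ck_on k F S \<Longrightarrow> Ck_on k (\<lambda>r. integral {0..1} (\<lambda>t. F (r, t))) W"
  proof (induction k arbitrary: F)
    case 0
    then show ?case using cont by simp
  next
    case (Suc k)
    have "continuous_on S (\<lambda>x. frechet_derivative F (at x) h)" for h
      using Suc.prems by (intro Ck_on_imp_continuous_on[of k]) (simp only: Ck_on.simps)
    then have "Ck_on (Suc 0) F S"
      using Suc.prems by simp
    then show ?case
    proof (rule Ck_on_Suc_intro[OF assms(1) D])
      fix h
      show "Ck_on k (\<lambda>r. integral {0..1} (\<lambda>t. frechet_derivative F (at (r, t)) (h, 0))) W"
        using Suc.IH[of "\<lambda>x. frechet_derivative F (at x) (h, 0)"] Suc.prems by simp
    qed
  qed
qed

lemma parametric_potential: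
  fixes g :: "'n::finite \<Rightarrow> real ^ 'n \<Rightarrow> real"
  assumes g: "\<And>i. i \<noteq> j \<Longrightarrow> smooth_on (g i) (ball a e)"
    and closed: "\<And>r i k. r \<in> ball a e \<Longrightarrow> i \<noteq> j \<Longrightarrow> k \<noteq> j \<Longrightarrow> partial k (g i) r = partial i (g k) r"
  obtains G where "smooth_on G (ball a e)"
    "\<And>r i. r \<in> ball a e \<Longrightarrow> i \<noteq> j \<Longrightarrow> partial i G r = g i r"
proof -
  \<comment> \<open>\<open>G r\<close> is the integral of \<open>\<Sum>i\<noteq>j. g i dr\<^sub>i\<close> along the segment \<open>t \<mapsto> c (r, t)\<close>, which ends at \<open>r\<close> and
    starts at the point with the coordinates of \<open>a\<close> except for the \<open>j\<close>-th, which is a mere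
    parameter and keeps the value \<open>r $ j\<close>.\<close>
  define P :: "real ^ 'n \<Rightarrow> real ^ 'n" where "P x = x - (x $ j) *\<^sub>R axis j 1" for x
  have P: "bounded_linear P"
    unfolding P_def
    by (intro bounded_linear_sub bounded_linear_ident bounded_linear_scaleR_const bounded_linear_vec_nth)
  have P_axis: "P (axis i 1) = axis i 1" if "i \<noteq> j" for i
    using that by (simp add: P_def axis_def)
  have P_nth: "P x $ i = (if i = j then 0 else x $ i)" for x i
    by (simp add: P_def axis_def)
  define c :: "(real ^ 'n) \<times> real \<Rightarrow> real ^ 'n" where "c q = fst q - (1 - snd q) *\<^sub>R P (fst q - a)" for q
  have Ckc: "Ck_on k c UNIV" for k
    unfolding c_def
    by (intro Ck_on_diff Ck_on_scaleR Ck_on_const Ck_on_bounded_linear_comp[OF P] open_UNIV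
        Ck_on_bounded_linear bounded_linear_fst bounded_linear_snd)
  have Dc: "(c has_derivative (\<lambda>h. fst h - ((1 - t) *\<^sub>R P (fst h) - snd h *\<^sub>R P (r - a)))) (at (r, t))" for r t
    unfolding c_def
    by (auto intro!: derivative_eq_intros bounded_linear.has_derivative[OF P] simp: algebra_simps)
  \<comment> \<open>An open set containing the product of the ball with the unit interval, on which
    every \<open>g i (c q)\<close> with \<open>i \<noteq> j\<close> is smooth.\<close>
  define S where "S = c -` ball a e"
  have S: "open S"
    unfolding S_def using Ckc[of 0] by (intro open_vimage) auto
  have sub: "ball a e \<times> {0..1} \<subseteq> S"
  proof (clarify)
    fix r and t :: real assume r: "r \<in> ball a e" and t: "t \<in> {0..1}"
    \<comment> \<open>A convex combination of \<open>r - a\<close> and its \<open>j\<close>-th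
      coordinate vector, neither of which is longer than \<open>r - a\<close>; the segment therefore
      stays in the ball.\<close>
    have "c (r, t) - a = t *\<^sub>R (r - a) + (1 - t) *\<^sub>R ((r - a) $ j) *\<^sub>R axis j 1"
      by (simp add: c_def P_def algebra_simps)
    then have "norm (c (r, t) - a) \<le> t * norm (r - a) + (1 - t) * \<bar>(r - a) $ j\<bar>"
      using norm_triangle_ineq[of "t *\<^sub>R (r - a)" "(1 - t) *\<^sub>R ((r - a) $ j) *\<^sub>R axis j 1"] t
      by (simp add: abs_mult)
    also have "\<dots> \<le> t * norm (r - a) + (1 - t) * norm (r - a)"
      using t component_le_norm_cart[of "r - a" j] by (intro add_mono mult_left_mono) auto
    also have "\<dots> < e"
      using r by (simp add: algebra_simps dist_norm norm_minus_commute)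
    finally show "(r, t) \<in> S"
      by (simp add: S_def dist_norm norm_minus_commute)
  qed
  define F where "F q = (\<Sum>i\<in>- {j}. g i (c q) * (fst q - a) $ i)" for q
  have CkF: "Ck_on k F S" for k
    unfolding F_def
  proof (intro Ck_on_sum Ck_on_mult S)
    fix i assume "i \<in> - {j}"
    then show "Ck_on k (\<lambda>q. g i (c q)) S"
      by (intro Ck_on_compose[OF S _ smooth_onD[OF g] Ck_on_subset[OF Ckc]]) (auto simp: S_def)
    show "Ck_on k (\<lambda>q. (fst q - a) $ i) S"
      by (intro Ck_on_bounded_linear_comp[OF bounded_linear_vec_nth] Ck_on_diff S Ck_on_const
          Ck_on_bounded_linear bounded_linear_fst)
  qed
  have Dg: "(g k has_derivative frechet_derivative (g k) (at x)) (at x)" if "k \<noteq> j" "x \<in> ball a e" for k x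
    using smooth_on_has_derivative g that by blast
  \<comment> \<open>Moving \<open>r\<close> in direction \<open>i \<noteq> j\<close> moves
    \<open>c (r, t)\<close> by \<open>t\<close> times as much, whence the factor \<open>t\<close>;
    the first term comes from differentiating \<open>(r - a) $ i\<close>.\<close>
  have DF: "frechet_derivative F (at (r, t)) (axis i 1, 0)
      = g i (c (r, t)) + t * (\<Sum>k\<in>- {j}. partial i (g k) (c (r, t)) * (r - a) $ k)"
    if q: "(r, t) \<in> S" and i: "i \<noteq> j" for r t i
  proof -
    let ?c' = "\<lambda>h. fst h - ((1 - t) *\<^sub>R P (fst h) - snd h *\<^sub>R P (r - a))"
    have cq: "c (r, t) \<in> ball a e" using q by (simp add: S_def)
    have "((\<lambda>q. g k (c q) * (fst q - a) $ k) has_derivative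
        (\<lambda>h. g k (c (r, t)) * fst h $ k + frechet_derivative (g k) (at (c (r, t))) (?c' h) * (r - a) $ k)) (at (r, t))"
      if "k \<in> - {j}" for k
    proof -
      have "((\<lambda>q. (fst q - a) $ k) has_derivative (\<lambda>h. fst h $ k)) (at (r, t))"
        by (auto intro!: derivative_eq_intros bounded_linear.has_derivative[OF bounded_linear_vec_nth])
      from has_derivative_mult[OF has_derivative_compose[OF Dc Dg] this] that cq
      show ?thesis by simp
    qed
    then have "(F has_derivative (\<lambda>h. \<Sum>k\<in>- {j}. g k (c (r, t)) * fst h $ k
        + frechet_derivative (g k) (at (c (r, t))) (?c' h) * (r - a) $ k)) (at (r, t))"
      unfolding F_def by (rule has_derivative_sum)
    then have "frechet_derivative F (at (r, t)) (axis i 1, 0)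
        = (\<Sum>k\<in>- {j}. g k (c (r, t)) * axis i 1 $ k
            + frechet_derivative (g k) (at (c (r, t))) (?c' (axis i 1, 0)) * (r - a) $ k)"
      by (simp add: frechet_derivative_at[symmetric])
    also have "\<dots> = (\<Sum>k\<in>- {j}. (if k = i then g i (c (r, t)) else 0) + t * (partial i (g k) (c (r, t)) * (r - a) $ k))"
    proof (rule sum.cong[OF refl])
      fix k assume k: "k \<in> - {j}"
      have "?c' (axis i 1, 0) = t *\<^sub>R axis i 1"
        using i by (simp add: P_axis algebra_simps)
      then have "frechet_derivative (g k) (at (c (r, t))) (?c' (axis i 1, 0)) = t * partial i (g k) (c (r, t))"
        using linear_scale[OF has_derivative_linear[OF Dg[OF _ cq]], of k t] k by (simp add: partial_def)
      then show "g k (c (r, t)) * axis i 1 $ k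
            + frechet_derivative (g k) (at (c (r, t))) (?c' (axis i 1, 0)) * (r - a) $ k
          = (if k = i then g i (c (r, t)) else 0) + t * (partial i (g k) (c (r, t)) * (r - a) $ k)"
        by (simp add: axis_def)
    qed
    also have "\<dots> = g i (c (r, t)) + t * (\<Sum>k\<in>- {j}. partial i (g k) (c (r, t)) * (r - a) $ k)"
      using i by (simp add: sum.distrib sum_distrib_left)
    finally show ?thesis .
  qed
  define G where "G r = integral {0..1} (\<lambda>t. F (r, t))" for r
  have "smooth_on G (ball a e)"
    unfolding smooth_on_def G_def
    using Ck_on_integral(2)[OF open_ball convex_ball S sub CkF] by blast
  moreover have "partial i G r = g i r" if r: "r \<in> ball a e" and i: "i \<noteq> j" for r i
  proof -
    have "partial i G r = integral {0..1} (\<lambda>t. frechet_derivative F (at (r, t)) (axis i 1, 0))"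
      unfolding partial_def G_def
      using frechet_derivative_at[OF Ck_on_integral(1)[OF open_ball convex_ball S sub CkF r]] by metis
    \<comment> \<open>By closedness the integrand is the \<open>t\<close>-derivative of
      \<open>t * g i (c (r, t))\<close>, so only the boundary values remain, and
      \<open>c (r, 1) = r\<close>.\<close>
    also have "\<dots> = 1 * g i (c (r, 1)) - 0 * g i (c (r, 0))"
    proof (rule integral_unique, rule fundamental_theorem_of_calculus)
      fix t :: real assume t: "t \<in> {0..1}"
      with r sub have q: "(r, t) \<in> S" by auto
      then have cq: "c (r, t) \<in> ball a e" by (simp add: S_def)
      have "((\<lambda>t. (r, t)) has_derivative (\<lambda>h. (0, h))) (at t)"
        by (auto intro!: derivative_eq_intros)
      from has_derivative_compose[OF this Dc]
      have "((\<lambda>t. c (r, t)) has_derivative (\<lambda>h. h *\<^sub>R P (r - a))) (at t)"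
        using linear_0[OF bounded_linear.linear[OF P]] by simp
      from has_derivative_compose[OF this Dg[OF i cq]]
      have "((\<lambda>t. g i (c (r, t))) has_derivative
          (\<lambda>h. h * frechet_derivative (g i) (at (c (r, t))) (P (r - a)))) (at t)"
        using linear_scale[OF has_derivative_linear[OF Dg[OF i cq]]] by simp
      from has_derivative_mult[OF has_derivative_ident this]
      have "((\<lambda>t. t * g i (c (r, t))) has_derivative
          (\<lambda>h. h * (g i (c (r, t)) + t * frechet_derivative (g i) (at (c (r, t))) (P (r - a))))) (at t)"
        by (simp add: algebra_simps)
      moreover have "frechet_derivative (g i) (at (c (r, t))) (P (r - a))
          = (\<Sum>k\<in>- {j}. partial i (g k) (c (r, t)) * (r - a) $ k)"
      proof -
        have "frechet_derivative (g i) (at (c (r, t))) (P (r - a))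
            = (\<Sum>k\<in>UNIV. partial k (g i) (c (r, t)) * P (r - a) $ k)"
          using Dg[OF i cq] by (intro frechet_derivative_partial) (auto simp: differentiable_def)
        \<comment> \<open>The projection \<open>P\<close> kills the \<open>j\<close>-th term, the
          only one about which the closedness hypothesis says nothing.\<close>
        also have "\<dots> = (\<Sum>k\<in>- {j}. partial k (g i) (c (r, t)) * P (r - a) $ k)"
          by (rule sum.mono_neutral_right) (auto simp: P_nth)
        also have "\<dots> = (\<Sum>k\<in>- {j}. partial i (g k) (c (r, t)) * (r - a) $ k)"
          by (rule sum.cong) (use closed[OF cq i] in \<open>auto simp: P_nth\<close>)
        finally show ?thesis .
      qed
      ultimately show "((\<lambda>t. t * g i (c (r, t))) has_vector_derivative
          frechet_derivative F (at (r, t)) (axis i 1, 0)) (at t within {0..1})"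
        unfolding has_vector_derivative_def DF[OF q i]
        by (auto intro: has_derivative_at_withinI)
    qed auto
    also have "\<dots> = g i r" by (simp add: c_def)
    finally show ?thesis .
  qed
  ultimately show ?thesis by (rule that)
qed

section \<open>The Riccati equation\<close>

text \<open>If the sine vanished, the unit vectors at the angles \<open>\<theta> i\<close> and
  \<open>\<theta> j\<close> would be proportional and the two roots would coincide projectively.
  This nonvanishing makes every \<open>cot\<close> of an angle difference a genuine, smooth
  cotangent.\<close>

lemma char_angles_sin_diff:
  assumes "char_angles M N \<theta>" "i \<noteq> j"
  shows "sin (\<theta> i - \<theta> j) \<noteq> 0"
proof
  assume 0: "sin (\<theta> i - \<theta> j) = 0"
  obtain \<beta> \<alpha> where ne: "\<not> proj_eq (\<beta> i, \<alpha> i) (\<beta> j, \<alpha> j)"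
    and pe: "\<And>k. proj_eq (sin (\<theta> k), cos (\<theta> k)) (\<beta> k, \<alpha> k)"
    using assms unfolding char_angles_def char_roots_def by blast
  obtain a b where a: "a \<noteq> 0" "(sin (\<theta> i), cos (\<theta> i)) = a *\<^sub>R (\<beta> i, \<alpha> i)"
    and b: "b \<noteq> 0" "(sin (\<theta> j), cos (\<theta> j)) = b *\<^sub>R (\<beta> j, \<alpha> j)"
    using pe[of i] pe[of j] unfolding proj_eq_def by blast
  define c where "c = cos (\<theta> i - \<theta> j)"
  have c: "c \<noteq> 0"
    using 0 sin_cos_squared_add[of "\<theta> i - \<theta> j"] by (auto simp: c_def)
  have "sin (\<theta> i) = c * sin (\<theta> j)" "cos (\<theta> i) = c * cos (\<theta> j)"
    using sin_add[of "\<theta> i - \<theta> j" "\<theta> j"] cos_add[of "\<theta> i - \<theta> j" "\<theta> j"] 0 by (simp_all add: c_def)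
  then have "a * \<beta> i = c * (b * \<beta> j)" "a * \<alpha> i = c * (b * \<alpha> j)"
    using a b by simp_all
  then have "(\<beta> i, \<alpha> i) = (c * b / a) *\<^sub>R (\<beta> j, \<alpha> j)"
    using a(1) by (simp add: field_simps)
  moreover have "c * b / a \<noteq> 0" using a b c by simp
  ultimately show False using ne unfolding proj_eq_def by blast
qed

text \<open>The computation for a single index \<open>i\<close>, with the original system already
  replaced by its diagonal form.\<close>

lemma riccati_equation:
  fixes r :: "real \<times> real \<Rightarrow> real ^ 'n::finite" and \<phi> :: "'n \<Rightarrow> real ^ 'n \<Rightarrow> real" and G :: "real ^ 'n \<Rightarrow> real"
  assumes \<Omega>: "open \<Omega>" and r: "smooth_on r \<Omega>" and rW: "r ` \<Omega> \<subseteq> W"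
    and \<phi>: "\<And>k. smooth_on (\<phi> k) W" and G: "smooth_on G W"
    and weight: "\<And>x k. x \<in> W \<Longrightarrow> k \<noteq> i \<Longrightarrow> partial k G x = partial k (\<phi> i) x * cot (\<phi> k x - \<phi> i x)"
    and hyp: "\<And>x k. x \<in> W \<Longrightarrow> k \<noteq> i \<Longrightarrow> sin (\<phi> k x - \<phi> i x) \<noteq> 0"
    and diag: "\<And>q k. q \<in> \<Omega> \<Longrightarrow> cos (\<phi> k (r q)) * lie (\<lambda>_. (1, 0)) r q $ k
        + sin (\<phi> k (r q)) * lie (\<lambda>_. (0, 1)) r q $ k = 0"
    and z: "z = (\<lambda>q. exp (- G (r q)) * lie (char_field_perp (\<lambda>q. \<phi> i (r q))) (\<lambda>q. r q $ i) q)"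
    and p: "p \<in> \<Omega>"
  shows "lie (char_field (\<lambda>q. \<phi> i (r q))) z p + exp (G (r p)) * partial i (\<phi> i) (r p) * (z p)\<^sup>2 = 0"
proof -
  define D where "D q = frechet_derivative r (at q)" for q
  have Dr: "(r has_derivative D q) (at q)" if "q \<in> \<Omega>" for q
    unfolding D_def using smooth_on_has_derivative[OF r that] .
  have Drk: "((\<lambda>q. r q $ k) has_derivative (\<lambda>h. D q h $ k)) (at q)" if "q \<in> \<Omega>" for q k
    using bounded_linear.has_derivative[OF bounded_linear_vec_nth Dr[OF that]] .
  have lin: "h = fst h *\<^sub>R (1, 0) + snd h *\<^sub>R (0, 1)" for h :: "real \<times> real"
    by (simp add: prod_eq_iff)
  have split: "L h = fst h * L (1, 0) + snd h * L (0, 1)" if "linear L"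
    for L :: "real \<times> real \<Rightarrow> real" and h
    using linear_add[OF that] linear_scale[OF that] lin[of h] by (metis real_scaleR_def)

  \<comment> \<open>The \<open>k\<close>-th diagonal equation says that the gradient of \<open>r\<^sub>k\<close> is \<open>w\<^sub>k\<close> times the unit normal
    of the \<open>k\<close>-th characteristic.\<close>
  define w where "w k q = - sin (\<phi> k (r q)) * D q (1, 0) $ k + cos (\<phi> k (r q)) * D q (0, 1) $ k" for k q
  have D_w: "D q (1, 0) $ k = - sin (\<phi> k (r q)) * w k q" "D q (0, 1) $ k = cos (\<phi> k (r q)) * w k q"
    if "q \<in> \<Omega>" for q k
  proof -
    let ?s = "sin (\<phi> k (r q))" and ?c = "cos (\<phi> k (r q))"
    have 1: "?c * D q (1, 0) $ k = - (?s * D q (0, 1) $ k)"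
      using diag[OF that, of k] by (simp add: lie_def D_def)
    then have 3: "?s * D q (0, 1) $ k = - (?c * D q (1, 0) $ k)" by simp
    have 2: "?s * ?s + ?c * ?c = 1"
      using sin_cos_squared_add[of "\<phi> k (r q)"] by (simp add: power2_eq_square)
    have "- ?s * w k q = ?s * ?s * D q (1, 0) $ k - ?c * (?s * D q (0, 1) $ k)"
      by (simp add: w_def algebra_simps)
    also have "\<dots> = (?s * ?s + ?c * ?c) * D q (1, 0) $ k"
      unfolding 3 by (simp only: distrib_right mult.assoc mult_minus_right diff_minus_eq_add)
    finally show "D q (1, 0) $ k = - ?s * w k q" using 2 by simp
    have "?c * w k q = ?c * ?c * D q (0, 1) $ k - ?s * (?c * D q (1, 0) $ k)"
      by (simp add: w_def algebra_simps)
    also have "\<dots> = (?c * ?c + ?s * ?s) * D q (0, 1) $ k"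
      unfolding 1 by (simp only: distrib_right mult.assoc mult_minus_right diff_minus_eq_add)
    finally show "D q (0, 1) $ k = ?c * w k q" using 2 by simp
  qed
  have lie_w: "lie (char_field_perp (\<lambda>q. \<phi> i (r q))) (\<lambda>q. r q $ i) q = w i q" if "q \<in> \<Omega>" for q
    unfolding lie_def frechet_derivative_at[OF Drk[OF that], symmetric]
    using split[OF has_derivative_linear[OF Drk[OF that]],
        of "char_field_perp (\<lambda>q. \<phi> i (r q)) q"]
    by (simp add: char_field_perp_def w_def)

  \<comment> \<open>\<open>f'\<close> and \<open>g'\<close> are the derivatives at \<open>p\<close>
    of \<open>\<phi> i\<close> and \<open>G\<close> evaluated along the solution.\<close>
  define f' where "f' h = (\<Sum>k\<in>UNIV. partial k (\<phi> i) (r p) * D p h $ k)" for h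
  define g' where "g' h = (\<Sum>k\<in>UNIV. partial k G (r p) * D p h $ k)" for h
  have rp: "r p \<in> W" using p rW by auto
  have Df: "((\<lambda>q. F (r q)) has_derivative (\<lambda>h. \<Sum>k\<in>UNIV. partial k F (r p) * D p h $ k)) (at p)"
    if "smooth_on F W" for F
  proof -
    have F: "(F has_derivative frechet_derivative F (at (r p))) (at (r p))"
      using smooth_on_has_derivative[OF that rp] .
    show ?thesis
      using has_derivative_compose[OF Dr[OF p] F] frechet_derivative_partial[OF differentiableI[OF F]]
      by simp
  qed
  note Df' = Df[OF \<phi>, of i, folded f'_def] and Dg' = Df[OF G, folded g'_def]

  have Ckr: "Ck_on 2 (\<lambda>q. r q $ i) \<Omega>"
    by (intro Ck_on_bounded_linear_comp[OF bounded_linear_vec_nth] \<Omega> smooth_onD r)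
  have CkX: "Ck_on 1 (\<lambda>q. D q h $ i) \<Omega>" for h
  proof (rule Ck_on_cong[OF _ \<Omega>])
    have "Ck_on (Suc 1) (\<lambda>q. r q $ i) \<Omega>"
      using Ckr by (simp only: numeral_2_eq_2 One_nat_def)
    then show "Ck_on 1 (\<lambda>q. frechet_derivative (\<lambda>q. r q $ i) (at q) h) \<Omega>"
      by (simp only: Ck_on.simps(2))
  qed (simp add: frechet_derivative_at[OF Drk, symmetric])
  have DX: "((\<lambda>q. D q h $ i) has_derivative frechet_derivative (\<lambda>q. D q h $ i) (at p)) (at p)" for h
    by (rule Ck_on_has_derivative[OF CkX[unfolded One_nat_def] p])
  have sym: "frechet_derivative (\<lambda>q. D q (1, 0) $ i) (at p) (0, 1)
      = frechet_derivative (\<lambda>q. D q (0, 1) $ i) (at p) (1, 0)"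
  proof -
    have "frechet_derivative (\<lambda>q. D q h $ i) (at p)
        = frechet_derivative (\<lambda>q. frechet_derivative (\<lambda>q. r q $ i) (at q) h) (at p)" for h
      by (rule frechet_derivative_transform_within_open[OF differentiableI[OF DX] \<Omega> p])
        (simp add: frechet_derivative_at[OF Drk, symmetric])
    then show ?thesis
      using second_derivative_symmetric[OF Ckr \<Omega> p] by simp
  qed

  let ?s = "sin (\<phi> i (r p))" and ?c = "cos (\<phi> i (r p))"
  have Dsin: "((\<lambda>q. sin (\<phi> i (r q))) has_derivative (\<lambda>h. ?c * f' h)) (at p)"
    and Dcos: "((\<lambda>q. cos (\<phi> i (r q))) has_derivative (\<lambda>h. - ?s * f' h)) (at p)"
    using Df' by (auto intro!: derivative_eq_intros)
  \<comment> \<open>The derivative \<open>w'\<close> stays abstract: all that is used about it comes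
    from differentiating the two identities \<open>D_w\<close> for the gradient of the
    \<open>i\<close>-th Riemann invariant, which gives \<open>X\<close> and
    \<open>Y\<close>.\<close>
  have "w i = (\<lambda>q. - sin (\<phi> i (r q)) * D q (1, 0) $ i + cos (\<phi> i (r q)) * D q (0, 1) $ i)"
    by (simp add: w_def fun_eq_iff)
  then have "w i differentiable (at p)"
    using has_derivative_add[OF has_derivative_mult[OF has_derivative_minus[OF Dsin] DX]
        has_derivative_mult[OF Dcos DX], of "(1, 0)" "(0, 1)"]
    by (simp only:) (rule differentiableI)
  then obtain w' where Dw: "(w i has_derivative w') (at p)"
    unfolding differentiable_def by (rule exE)
  have "((\<lambda>q. - sin (\<phi> i (r q)) * w i q) has_derivative
      (\<lambda>h. - ?s * w' h + - (?c * f' h) * w i p)) (at p)"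
    by (rule has_derivative_mult[OF has_derivative_minus[OF Dsin] Dw])
  then have "((\<lambda>q. D q (1, 0) $ i) has_derivative (\<lambda>h. - ?s * w' h + - (?c * f' h) * w i p)) (at p)"
    by (rule has_derivative_transform_within_open[OF _ \<Omega> p]) (simp add: D_w)
  then have X: "frechet_derivative (\<lambda>q. D q (1, 0) $ i) (at p) (0, 1)
      = - ?s * w' (0, 1) + - (?c * f' (0, 1)) * w i p"
    by (simp add: frechet_derivative_at[symmetric])
  have "((\<lambda>q. cos (\<phi> i (r q)) * w i q) has_derivative
      (\<lambda>h. ?c * w' h + - ?s * f' h * w i p)) (at p)"
    by (rule has_derivative_mult[OF Dcos Dw])
  then have "((\<lambda>q. D q (0, 1) $ i) has_derivative (\<lambda>h. ?c * w' h + - ?s * f' h * w i p)) (at p)"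
    by (rule has_derivative_transform_within_open[OF _ \<Omega> p]) (simp add: D_w)
  then have Y: "frechet_derivative (\<lambda>q. D q (0, 1) $ i) (at p) (1, 0)
      = ?c * w' (1, 0) + - ?s * f' (1, 0) * w i p"
    by (simp add: frechet_derivative_at[symmetric])

  let ?v = "(?c, ?s)"
  have "w' ?v = ?c * w' (1, 0) + ?s * w' (0, 1)"
    using split[OF has_derivative_linear[OF Dw], of ?v] by simp
  \<comment> \<open>Symmetry equates \<open>X\<close> and \<open>Y\<close>. The bracket is minus the
    derivative of \<open>\<phi> i\<close> along the unit normal \<open>(- ?s, ?c)\<close>.\<close>
  also have "\<dots> = w i p * (?s * f' (1, 0) - ?c * f' (0, 1))"
    using sym unfolding X Y by (simp add: algebra_simps)
  finally have w'v: "w' ?v = w i p * (?s * f' (1, 0) - ?c * f' (0, 1))" .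
  have g'v: "g' ?v = ?c * g' (1, 0) + ?s * g' (0, 1)"
    using split[OF has_derivative_linear[OF Dg'], of ?v] by simp
  have "?s * f' (1, 0) - ?c * f' (0, 1) - g' ?v
      = (\<Sum>k\<in>UNIV. partial k (\<phi> i) (r p) * (?s * D p (1, 0) $ k - ?c * D p (0, 1) $ k)
          - partial k G (r p) * (?c * D p (1, 0) $ k + ?s * D p (0, 1) $ k))"
    unfolding g'v unfolding f'_def g'_def
    by (simp add: sum_distrib_left sum_subtractf[symmetric] sum.distrib[symmetric] algebra_simps)
  also have "\<dots> = (\<Sum>k\<in>UNIV. if k = i then - partial i (\<phi> i) (r p) * w i p else 0)"
  proof (rule sum.cong[OF refl])
    fix k
    \<comment> \<open>The angle from the \<open>i\<close>-th to the \<open>k\<close>-th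
      characteristic direction. Facts \<open>1\<close> and \<open>2\<close> say that the
      \<open>k\<close>-th invariant has normal derivative \<open>cos \<delta> * w k p\<close> and
      tangential derivative \<open>- (sin \<delta> * w k p)\<close> with respect to the
      \<open>i\<close>-th characteristic.\<close>
    define \<delta> where "\<delta> = \<phi> k (r p) - \<phi> i (r p)"
    have 1: "?s * D p (1, 0) $ k - ?c * D p (0, 1) $ k = - (cos \<delta> * w k p)"
      unfolding D_w[OF p] \<delta>_def cos_diff by (simp add: algebra_simps)
    have 2: "?c * D p (1, 0) $ k + ?s * D p (0, 1) $ k = - (sin \<delta> * w k p)"
      unfolding D_w[OF p] \<delta>_def sin_diff by (simp add: algebra_simps)
    show "partial k (\<phi> i) (r p) * (?s * D p (1, 0) $ k - ?c * D p (0, 1) $ k)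
        - partial k G (r p) * (?c * D p (1, 0) $ k + ?s * D p (0, 1) $ k)
        = (if k = i then - partial i (\<phi> i) (r p) * w i p else 0)"
    proof (cases "k = i")
      case True
      \<comment> \<open>Here \<open>\<delta> = 0\<close>, so the term with
        \<open>partial i G\<close> vanishes: the \<open>i\<close>-th invariant is constant along its
        own characteristic.\<close>
      then show ?thesis unfolding 1 2 by (simp add: \<delta>_def)
    next
      case False
      \<comment> \<open>The weight equation multiplied by the nonzero sine; the tangential change of
        \<open>G\<close> then cancels the normal change of \<open>\<phi> i\<close>.\<close>
      then have "partial k G (r p) * sin \<delta> = partial k (\<phi> i) (r p) * cos \<delta>"
        using weight[OF rp False] hyp[OF rp False] by (simp add: \<delta>_def cot_def)
      then show ?thesis unfolding 1 2 using False by (simp add: algebra_simps)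
    qed
  qed
  also have "\<dots> = - partial i (\<phi> i) (r p) * w i p" by simp
  finally have E: "?s * f' (1, 0) - ?c * f' (0, 1) - g' ?v = - partial i (\<phi> i) (r p) * w i p" .
  have "w' ?v - g' ?v * w i p = w i p * (?s * f' (1, 0) - ?c * f' (0, 1) - g' ?v)"
    unfolding w'v by (simp add: algebra_simps)
  also have "\<dots> = - (partial i (\<phi> i) (r p) * (w i p)\<^sup>2)"
    unfolding E by (simp add: power2_eq_square)
  finally have key: "w' ?v - g' ?v * w i p = - (partial i (\<phi> i) (r p) * (w i p)\<^sup>2)" .

  have "((\<lambda>q. exp (- G (r q)) * w i q) has_derivative
      (\<lambda>h. exp (- G (r p)) * (w' h - g' h * w i p))) (at p)"
    using Dg' Dw by (auto intro!: derivative_eq_intros simp: algebra_simps)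
  then have "(z has_derivative (\<lambda>h. exp (- G (r p)) * (w' h - g' h * w i p))) (at p)"
    by (rule has_derivative_transform_within_open[OF _ \<Omega> p]) (simp add: z lie_w)
  then have "lie (char_field (\<lambda>q. \<phi> i (r q))) z p = exp (- G (r p)) * (w' ?v - g' ?v * w i p)"
    by (simp add: lie_def char_field_def frechet_derivative_at[symmetric])
  also have "\<dots> = - (exp (- G (r p)) * partial i (\<phi> i) (r p) * (w i p)\<^sup>2)"
    unfolding key by simp
  finally have L: "lie (char_field (\<lambda>q. \<phi> i (r q))) z p
      = - (exp (- G (r p)) * partial i (\<phi> i) (r p) * (w i p)\<^sup>2)" .
  \<comment> \<open>The square of \<open>z p\<close> carries two factors
    \<open>exp (- G (r p))\<close>, and \<open>exp (G (r p))\<close> removes one of them, matching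
    \<open>L\<close>.\<close>
  have "exp (G (r p)) * exp (- G (r p)) = 1" by (simp add: exp_minus)
  moreover have "exp (G (r p)) * partial i (\<phi> i) (r p) * (exp (- G (r p)) * w i p)\<^sup>2
      = (exp (G (r p)) * exp (- G (r p))) * (exp (- G (r p)) * partial i (\<phi> i) (r p) * (w i p)\<^sup>2)"
    by (simp only: power2_eq_square ac_simps)
  ultimately have "exp (G (r p)) * partial i (\<phi> i) (r p) * (exp (- G (r p)) * w i p)\<^sup>2
      = exp (- G (r p)) * partial i (\<phi> i) (r p) * (w i p)\<^sup>2"
    by simp
  then show ?thesis unfolding L using lie_w[OF p] by (simp add: z)
qed

section \<open>Existence of the weights\<close>

text \<open>Each \<open>j\<close> gives a separate problem for \<open>parametric_potential\<close>.
  The ball depends only on \<open>r0\<close> and \<open>V\<close>, so one neighbourhood serves all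
  indices.\<close>

lemma riccati_weights_exist:
  assumes V: "open V" and \<phi>: "\<And>i. smooth_on (\<phi> i) V"
    and hyp: "\<And>x i j. x \<in> V \<Longrightarrow> i \<noteq> j \<Longrightarrow> sin (\<phi> i x - \<phi> j x) \<noteq> 0"
    and closed: "\<And>x i j k. x \<in> V \<Longrightarrow> i \<noteq> j \<Longrightarrow> k \<noteq> j \<Longrightarrow>
        partial k (\<lambda>s. partial i (\<phi> j) s * cot (\<phi> i s - \<phi> j s)) x =
        partial i (\<lambda>s. partial k (\<phi> j) s * cot (\<phi> k s - \<phi> j s)) x"
    and r0: "r0 \<in> V"
  shows "\<exists>W G. open W \<and> r0 \<in> W \<and> W \<subseteq> V \<and> riccati_weights \<phi> W G"
proof -
  obtain e where e: "e > 0" "ball r0 e \<subseteq> V"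
    using V r0 open_contains_ball by blast
  let ?g = "\<lambda>j i s. partial i (\<phi> j) s * cot (\<phi> i s - \<phi> j s)"
  have "\<exists>G. smooth_on G (ball r0 e) \<and> (\<forall>r\<in>ball r0 e. \<forall>i. i \<noteq> j \<longrightarrow> partial i G r = ?g j i r)" for j
  proof (rule parametric_potential[of j "?g j" r0 e])
    show "smooth_on (?g j i) (ball r0 e)" if "i \<noteq> j" for i
      unfolding smooth_on_def
    proof
      fix k
      have "Ck_on k (partial i (\<phi> j)) V"
        by (rule Ck_on_partial[OF smooth_onD[OF \<phi>]])
      moreover have "Ck_on k (\<lambda>s. cot (\<phi> i s - \<phi> j s)) V"
        using hyp[OF _ that] by (rule Ck_on_cot[OF V Ck_on_diff[OF V smooth_onD[OF \<phi>] smooth_onD[OF \<phi>]]])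
      ultimately have "Ck_on k (?g j i) V"
        by (rule Ck_on_mult[OF V])
      then show "Ck_on k (?g j i) (ball r0 e)"
        using e(2) by (rule Ck_on_subset)
    qed
    show "partial k (?g j i) r = partial i (?g j k) r" if "r \<in> ball r0 e" "i \<noteq> j" "k \<noteq> j" for r i k
      using that e(2) by (intro closed) auto
  qed blast
  then have "\<forall>j. \<exists>G. smooth_on G (ball r0 e) \<and>
      (\<forall>r\<in>ball r0 e. \<forall>i. i \<noteq> j \<longrightarrow> partial i G r = ?g j i r)" by (rule allI)
  from choice[OF this] obtain G where "\<forall>j. smooth_on (G j) (ball r0 e) \<and>
      (\<forall>r\<in>ball r0 e. \<forall>i. i \<noteq> j \<longrightarrow> partial i (G j) r = ?g j i r)" by (rule exE)
  then have "riccati_weights \<phi> (ball r0 e) G"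
    unfolding riccati_weights_def by simp
  then show ?thesis using e by (intro exI[of _ "ball r0 e"]) auto
qed

section \<open>From the original system to Riemann invariants\<close>

text \<open>By the chain rule the derivative of \<open>u\<close> is the Jacobian of
  \<open>\<Psi>\<close> applied to that of \<open>r\<close>; multiplying the system by
  \<open>C (r p)\<close> from the left produces the diagonal matrices, and the \<open>k\<close>-th
  row is the claim.\<close>

lemma diagonal_form_solution:
  fixes r :: "real \<times> real \<Rightarrow> real ^ 'n::finite"
  assumes form: "can_be_written_as A B U V \<Psi> (\<lambda>r. diag_matrix (a r)) (\<lambda>r. diag_matrix (b r))"
    and sol: "is_solution A B \<Omega> u" and \<Omega>: "open \<Omega>" and r: "smooth_on r \<Omega>"
    and rV: "\<And>p. p \<in> \<Omega> \<Longrightarrow> r p \<in> V" and u: "\<And>p. p \<in> \<Omega> \<Longrightarrow> \<Psi> (r p) = u p" and p: "p \<in> \<Omega>"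
  shows "a (r p) k * lie (\<lambda>_. (1, 0)) r p $ k + b (r p) k * lie (\<lambda>_. (0, 1)) r p $ k = 0"
proof -
  have \<Psi>: "smooth_on \<Psi> V"
    using form by (simp add: can_be_written_as_def regular_change_of_variables_def)
  obtain C where C: "C (r p) ** A (u p) ** jacobian \<Psi> (at (r p)) = diag_matrix (a (r p))"
    "C (r p) ** B (u p) ** jacobian \<Psi> (at (r p)) = diag_matrix (b (r p))"
    using form rV[OF p] u[OF p] unfolding can_be_written_as_def by metis
  let ?J = "jacobian \<Psi> (at (r p))" and ?D = "frechet_derivative r (at p)"
  have "(\<Psi> has_derivative (\<lambda>h. ?J *v h)) (at (r p))"
    using smooth_on_has_derivative[OF \<Psi> rV[OF p]] jacobian_works differentiableI by blast
  from has_derivative_compose[OF smooth_on_has_derivative[OF r p] this]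
  have "((\<lambda>q. \<Psi> (r q)) has_derivative (\<lambda>h. ?J *v ?D h)) (at p)" .
  then have "(u has_derivative (\<lambda>h. ?J *v ?D h)) (at p)"
    by (rule has_derivative_transform_within_open[OF _ \<Omega> p]) (rule u)
  then have "frechet_derivative u (at p) = (\<lambda>h. ?J *v ?D h)"
    by (simp add: frechet_derivative_at[symmetric])
  moreover have "A (u p) *v frechet_derivative u (at p) (1, 0)
      + B (u p) *v frechet_derivative u (at p) (0, 1) = 0"
    using sol p by (simp add: is_solution_def lie_def)
  ultimately have "A (u p) *v (?J *v ?D (1, 0)) + B (u p) *v (?J *v ?D (0, 1)) = 0"
    by simp
  then have "C (r p) *v (A (u p) *v (?J *v ?D (1, 0)) + B (u p) *v (?J *v ?D (0, 1))) = 0"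
    by simp
  then have "diag_matrix (a (r p)) *v ?D (1, 0) + diag_matrix (b (r p)) *v ?D (0, 1) = 0"
    by (simp add: matrix_vector_right_distrib matrix_vector_mul_assoc matrix_mul_assoc C)
  moreover have "(diag_matrix d *v x) $ k = d k * x $ k" for d and x :: "real ^ 'n"
    by (simp add: diag_matrix_def matrix_vector_mult_def if_distrib[of "\<lambda>y. y * _"] cong: if_cong)
  ultimately show ?thesis
    unfolding lie_def by (metis vector_add_component zero_index)
qed

theorem theorem1p2:
  fixes A B :: "real ^ 'n::finite \<Rightarrow> real ^ 'n ^ 'n"
    and U V :: "(real ^ 'n) set"
    and \<Psi> :: "real ^ 'n \<Rightarrow> real ^ 'n"
    and \<phi> :: "'n \<Rightarrow> real ^ 'n \<Rightarrow> real"
  assumes "open U"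
    and "smooth_on A U" and "smooth_on B U"
    and "\<forall>u\<in>U. \<exists>\<alpha> \<beta>. char_form (A u) (B u) \<alpha> \<beta> \<noteq> 0"
    and "\<forall>u\<in>U. strictly_hyperbolic (A u) (B u)"
    and "\<forall>i. smooth_on (\<phi> i) V"
    and "\<forall>r\<in>V. char_angles (A (\<Psi> r)) (B (\<Psi> r)) (\<lambda>i. \<phi> i r)"
    and "rich A B U V \<Psi> \<phi>"
  shows "(\<forall>r0\<in>V. \<exists>W G. open W \<and> r0 \<in> W \<and> W \<subseteq> V \<and> riccati_weights \<phi> W G) \<and>
    (\<forall>W G \<Omega> u r. open W \<and> W \<subseteq> V \<and> riccati_weights \<phi> W G \<and>
        open \<Omega> \<and> smooth_on u \<Omega> \<and> u ` \<Omega> \<subseteq> U \<and> is_solution A B \<Omega> u \<and>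
        (\<forall>p\<in>\<Omega>. r p \<in> W \<and> \<Psi> (r p) = u p) \<longrightarrow>
      (\<forall>i. let v = char_field (\<lambda>p. \<phi> i (r p));
               w = lie (char_field_perp (\<lambda>p. \<phi> i (r p))) (\<lambda>p. r p $ i);
               z = (\<lambda>p. exp (- G i (r p)) * w p)
           in \<forall>p\<in>\<Omega>. lie v z p + exp (G i (r p)) * partial i (\<phi> i) (r p) * (z p)\<^sup>2 = 0))"
proof (intro conjI ballI allI impI)
  have form: "can_be_written_as A B U V \<Psi>
       (\<lambda>r. diag_matrix (\<lambda>i. cos (\<phi> i r))) (\<lambda>r. diag_matrix (\<lambda>i. sin (\<phi> i r)))"
    using assms(8) unfolding rich_def by blast
  then have cov: "open V" "bij_betw \<Psi> V U" "smooth_on (the_inv_into V \<Psi>) U"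
    unfolding can_be_written_as_def regular_change_of_variables_def by blast+
  have hyp: "sin (\<phi> i x - \<phi> j x) \<noteq> 0" if "x \<in> V" "i \<noteq> j" for x i j
    using char_angles_sin_diff assms(7) that by blast
  show "\<exists>W G. open W \<and> r0 \<in> W \<and> W \<subseteq> V \<and> riccati_weights \<phi> W G" if "r0 \<in> V" for r0
  proof (rule riccati_weights_exist[OF cov(1) _ hyp _ that])
    show "smooth_on (\<phi> i) V" for i using assms(6) by blast
    show "partial k (\<lambda>s. partial i (\<phi> j) s * cot (\<phi> i s - \<phi> j s)) x =
        partial i (\<lambda>s. partial k (\<phi> j) s * cot (\<phi> k s - \<phi> j s)) x"
      if "x \<in> V" "i \<noteq> j" "k \<noteq> j" for x i j k
      using assms(8) that by (simp add: rich_def)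
  qed
  fix W G \<Omega> u r i
  assume *: "open W \<and> W \<subseteq> V \<and> riccati_weights \<phi> W G \<and>
        open \<Omega> \<and> smooth_on u \<Omega> \<and> u ` \<Omega> \<subseteq> U \<and> is_solution A B \<Omega> u \<and>
        (\<forall>p\<in>\<Omega>. r p \<in> W \<and> \<Psi> (r p) = u p)"
  \<comment> \<open>Smoothness of \<open>r\<close> is inherited from \<open>u\<close> through the
    smooth inverse of the change of variables.\<close>
  have "r p = the_inv_into V \<Psi> (u p)" if "p \<in> \<Omega>" for p
    using * cov(2) that by (metis bij_betw_imp_inj_on subsetD the_inv_into_f_f)
  note inv = this
  have "Ck_on k r \<Omega>" for k
  proof (rule Ck_on_cong)
    have "u ` \<Omega> \<subseteq> U" "Ck_on k u \<Omega>" "open \<Omega>" using * by (auto simp: smooth_on_def)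
    then show "Ck_on k (\<lambda>p. the_inv_into V \<Psi> (u p)) \<Omega>"
      using Ck_on_compose[OF _ _ smooth_onD[OF cov(3)]] by blast
  qed (use * inv in auto)
  then have r: "smooth_on r \<Omega>" by (simp add: smooth_on_def)
  have diag: "cos (\<phi> k (r p)) * lie (\<lambda>_. (1, 0)) r p $ k + sin (\<phi> k (r p)) * lie (\<lambda>_. (0, 1)) r p $ k = 0"
    if "p \<in> \<Omega>" for p k
    using * that by (intro diagonal_form_solution[OF form _ _ r]) auto
  show "let v = char_field (\<lambda>p. \<phi> i (r p));
               w = lie (char_field_perp (\<lambda>p. \<phi> i (r p))) (\<lambda>p. r p $ i);
               z = (\<lambda>p. exp (- G i (r p)) * w p)
           in \<forall>p\<in>\<Omega>. lie v z p + exp (G i (r p)) * partial i (\<phi> i) (r p) * (z p)\<^sup>2 = 0"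
    unfolding Let_def
  proof
    fix p assume "p \<in> \<Omega>"
    show "lie (char_field (\<lambda>p. \<phi> i (r p)))
        (\<lambda>p. exp (- G i (r p)) * lie (char_field_perp (\<lambda>p. \<phi> i (r p))) (\<lambda>p. r p $ i) p) p
      + exp (G i (r p)) * partial i (\<phi> i) (r p) *
        (exp (- G i (r p)) * lie (char_field_perp (\<lambda>p. \<phi> i (r p))) (\<lambda>p. r p $ i) p)\<^sup>2 = 0"
    proof (rule riccati_equation[OF _ r _ _ _ _ _ _ refl \<open>p \<in> \<Omega>\<close>, where W = W and \<phi> = \<phi> and G = "G i" and i = i])
      show "smooth_on (\<phi> k) W" for k
        using * assms(6) Ck_on_subset[of _ "\<phi> k" V W] by (simp add: smooth_on_def)
      show "partial k (G i) x = partial k (\<phi> i) x * cot (\<phi> k x - \<phi> i x)" if "x \<in> W" "k \<noteq> i" for x k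
        using * that by (simp add: riccati_weights_def)
      show "sin (\<phi> k x - \<phi> i x) \<noteq> 0" if "x \<in> W" "k \<noteq> i" for x k
        using * that by (intro hyp) auto
      show "open \<Omega>" "r ` \<Omega> \<subseteq> W" "smooth_on (G i) W"
        using * by (auto simp: riccati_weights_def)
    qed (rule diag)
  qed
qed

end
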